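(* Let $u,v,q$ be complex parameters (generic, so no denominator vanishes). Let $K_7(n):=K(q^2,q^{-n},q^{1-n},q^{2-n},q^{3-n},u,v,q^4)$ for $n\ge0$. Put \[ I_r:=\frac{(q^4u,q^4v,q^6/u,q^6/v;q^4)_r}{(u,v,q^2/u,q^2/v;q^4)_r},\qquad J_r:=\frac{(q^2u,q^2v,q^4/u,q^4/v;q^4)_r}{(u/q^2,v/q^2,1/u,1/v;q^4)_r}. \] (i) The sequences with $\alpha_0=\beta_0=1$ and, for $r\ge0$ in the first two and $r\ge1$ in the last two formulas, \[ \alpha_{4r}=I_rq^{8r^2-8r},\quad \alpha_{4r+1}=-I_rq^{8r^2+2},\quad \alpha_{4r-1}=J_rq^{8r^2-8r},\quad \alpha_{4r-2}=-J_rq^{8r^2-16r+2}, \] \[ \beta_n=K_7(n)\frac{(-q;q^2)_n}{(q^2;q)_{2n}}, \] form a Bailey pair relative to $a=q$. (ii) The sequences with $\alpha_0=\beta_0=1$ and, with the same ranges of $r$, \[ \alpha_{4r}=I_rq^{8r^2-4r},\quad \alpha_{4r+1}=-I_rq^{8r^2-4r},\quad \alpha_{4r-1}=J_rq^{8r^2-12r},\quad \alpha_{4r-2}=-J_rq^{8r^2-12r}, \] \[ \beta_n=K_7(n)\frac{q^n(-q;q^2)_n}{(q^2;q)_{2n}}, \] form a Bailey pair relative to $a=q$.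
   Context: Notation: $(x;q)_n=\prod_{k=0}^{n-1}(1-xq^k)$ and $(x_1,\dots,x_k;q)_n=(x_1;q)_n\cdots(x_k;q)_n$. A pair of sequences $(\alpha_n)_{n\ge0},(\beta_n)_{n\ge0}$ is a Bailey pair relative to $a$ if $\alpha_0=1$ and $\beta_n=\sum_{j=0}^{n}\frac{\alpha_j}{(q;q)_{n-j}(aq;q)_{n+j}}$ for all $n\ge0$. The function $K$: for complex $a,b,c,d,e,u,v$ and a base $p$, let $\sigma_1,\dots,\sigma_4$ be the elementary symmetric functions of $b,c,d,e$ and \[ K(a,b,c,d,e,u,v,p):=\frac{uv(\sigma_3-a\sigma_1)(p\sigma_3-a\sigma_1)a^2+(1-p)uv(a^2-\sigma_4)(a^2-\sigma_2a+\sigma_4)a+(u+v)(a+uv)(\sigma_3-a\sigma_1)(a^2-p\sigma_4)a+(u^2+a)(v^2+a)(a^2-\sigma_4)(a^2-p\sigma_4)}{(a^2-bcde)(a^2-bcde\,p)(1-u)(a-u)(1-v)(a-v)}. \] *)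

theory Defs
  imports Complex_Main
begin

definition qpoch :: "complex \<Rightarrow> complex \<Rightarrow> nat \<Rightarrow> complex" where
  "qpoch x q n = (\<Prod>k<n. 1 - x * q ^ k)"

definition qpochs :: "complex list \<Rightarrow> complex \<Rightarrow> nat \<Rightarrow> complex" where
  "qpochs xs q n = (\<Prod>x\<leftarrow>xs. qpoch x q n)"

definition bailey_pair ::
  "complex \<Rightarrow> complex \<Rightarrow> (nat \<Rightarrow> complex) \<Rightarrow> (nat \<Rightarrow> complex) \<Rightarrow> bool" where
  "bailey_pair q a \<alpha> \<beta> \<longleftrightarrow>
     \<alpha> 0 = 1 \<and>
     (\<forall>n. \<beta> n = (\<Sum>j\<le>n. \<alpha> j / (qpoch q q (n - j) * qpoch (a * q) q (n + j))))"

definition K_fun ::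
  "complex \<Rightarrow> complex \<Rightarrow> complex \<Rightarrow> complex \<Rightarrow> complex \<Rightarrow> complex \<Rightarrow> complex \<Rightarrow> complex \<Rightarrow> complex"
where
  "K_fun a b c d e u v p =
    (let s1 = b + c + d + e;
         s2 = b*c + b*d + b*e + c*d + c*e + d*e;
         s3 = b*c*d + b*c*e + b*d*e + c*d*e;
         s4 = b*c*d*e
     in
      (u*v * (s3 - a*s1) * (p*s3 - a*s1) * a^2
        + (1 - p) * u*v * (a^2 - s4) * (a^2 - s2*a + s4) * a
        + (u + v) * (a + u*v) * (s3 - a*s1) * (a^2 - p*s4) * a
        + (u^2 + a) * (v^2 + a) * (a^2 - s4) * (a^2 - p*s4))
      / ((a^2 - b*c*d*e) * (a^2 - b*c*d*e*p) * (1 - u) * (a - u) * (1 - v) * (a - v)))"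

definition K7 :: "complex \<Rightarrow> complex \<Rightarrow> complex \<Rightarrow> nat \<Rightarrow> complex" where
  "K7 u v q n =
     K_fun (q^2) (q powi (- int n)) (q powi (1 - int n)) (q powi (2 - int n)) (q powi (3 - int n))
       u v (q^4)"

lemma K7_0:
  assumes "q \<noteq> 0" "q ^ 2 \<noteq> 1" "q ^ 6 \<noteq> 1" "u \<noteq> 1" "u \<noteq> q^2" "v \<noteq> 1" "v \<noteq> q^2"
  shows "K7 u v q 0 = 1"
proof -
  have "(q^2)^2 - 1*q*q^2*q^3 = q^4 * (1 - q^2)" "(q^2)^2 - 1*q*q^2*q^3*q^4 = q^4 * (1 - q^6)"
    by algebra+
  then have nz: "((q^2)^2 - 1*q*q^2*q^3) * ((q^2)^2 - 1*q*q^2*q^3*q^4)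
      * (1 - u) * (q^2 - u) * (1 - v) * (q^2 - v) \<noteq> 0"
    using assms by simp
  have pw: "q powi (- int 0) = 1" "q powi (1 - int 0) = q"
    "q powi (2 - int 0) = q^2" "q powi (3 - int 0) = q^3"
    by simp_all
  show ?thesis
    unfolding K7_def K_fun_def Let_def pw
    by (rule divide_eq_1_iff[THEN iffD2], rule conjI, rule nz, algebra)
qed

definition I7 :: "complex \<Rightarrow> complex \<Rightarrow> complex \<Rightarrow> nat \<Rightarrow> complex" where
  "I7 u v q r =
     qpochs [q^4 * u, q^4 * v, q^6 / u, q^6 / v] (q^4) r
     / qpochs [u, v, q^2 / u, q^2 / v] (q^4) r"

definition J7 :: "complex \<Rightarrow> complex \<Rightarrow> complex \<Rightarrow> nat \<Rightarrow> complex" where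
  "J7 u v q r =
     qpochs [q^2 * u, q^2 * v, q^4 / u, q^4 / v] (q^4) r
     / qpochs [u / q^2, v / q^2, 1 / u, 1 / v] (q^4) r"

end

theory Submission
  imports Defs
begin

text \<open>
  The quotients \<open>I\<^sub>r\<close> and \<open>J\<^sub>r\<close> collapse to polynomials in \<open>x = q\<^bsup>4r\<^esup>\<close>, and \<open>J\<^sub>r = q\<^bsup>16r\<^esup> I\<^bsub>-r\<^esub>\<close>,
  so both Bailey sums become the bilateral sum over \<open>r\<close> of
  \<open>t\<^sub>r = q\<^bsup>8r^2\<^esup> (1 - q\<^sup>2x\<^sup>2) / ((q;q)\<^bsub>n-4r\<^esub> (q;q)\<^bsub>n+4r+2\<^esub>)\<close> against a quadratic polynomial in
  \<open>Y = 1/x + q\<^sup>2x\<close>; in part (ii) there is an extra factor \<open>q\<^sup>n\<close>.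
  Telescoping \<open>g\<^sub>r = q\<^bsup>8r^2-4r\<^esup> \<rho>\<^sub>r / ((q;q)\<^bsub>n-4r\<^esub> (q;q)\<^bsub>n+4r-2\<^esub>)\<close> with \<open>\<rho>\<^sub>r = 1\<close> and
  \<open>\<rho>\<^sub>r = x/q + q/x\<close> expresses the sums of \<open>t\<^sub>r Y\<close> and \<open>t\<^sub>r Y\<^sup>2\<close> through the sum of \<open>t\<^sub>r\<close>.
  Since \<open>t\<^sub>r\<close> at \<open>n\<close> is \<open>1 + q\<^sup>2M\<^sup>2 - MY\<close> times \<open>t\<^sub>r\<close> at \<open>n+1\<close>, where \<open>M = q\<^bsup>n+1\<^esup>\<close>, the first of these
  relations is also a first-order recurrence in \<open>n\<close> for the sum of \<open>t\<^sub>r\<close>, which evaluates it.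
\<close>

section \<open>Shifts and reciprocals of q-Pochhammer symbols\<close>

lemma qpoch_Suc: "qpoch x q (Suc n) = qpoch x q n * (1 - x * q ^ n)"
  by (simp add: qpoch_def)

lemma qpoch_self_Suc: "qpoch q q (Suc n) = (1 - q) * qpoch (q\<^sup>2) q n"
  unfolding qpoch_def by (subst prod.lessThan_Suc_shift) (simp add: power2_eq_square mult.assoc)

text \<open>Both sides are \<open>qpoch z p (Suc r)\<close>, with the first or the last factor split
  off.\<close>

lemma qpoch_shift: "qpoch (p * z) p r * (1 - z) = qpoch z p r * (1 - z * p ^ r)"
proof (induction r)
  case (Suc r)
  have "qpoch (p * z) p (Suc r) * (1 - z) = (qpoch (p * z) p r * (1 - z)) * (1 - p * z * p ^ r)"
    by (simp add: qpoch_Suc)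
  also have "\<dots> = qpoch z p (Suc r) * (1 - z * p ^ Suc r)"
    unfolding Suc.IH by (simp add: qpoch_Suc algebra_simps)
  finally show ?case .
qed (simp add: qpoch_def)

lemma qpoch_shift_quotient:
  assumes "qpoch z p r \<noteq> 0" "z \<noteq> 1"
  shows "qpoch (p * z) p r / qpoch z p r = (1 - z * p ^ r) / (1 - z)"
  using qpoch_shift[of p z r] assms by (simp add: field_simps)

lemma qpoch_one_sub_ne_0:
  assumes "\<And>n. qpoch z p n \<noteq> 0"
  shows "z \<noteq> 1"
  using assms[of 1] by (auto simp: qpoch_def)

text \<open>\<open>1 - q ^ k\<close> is the last factor of \<open>qpoch q q k\<close>.\<close>

lemma not_root_of_unity:
  assumes "\<And>n. qpoch q q n \<noteq> 0" "0 < k"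
  shows "q ^ k \<noteq> 1"
  using assms(1)[of k] assms(2) qpoch_Suc[of q q "k - 1"] by (cases k) auto

text \<open>The reciprocal of \<open>(q;q)\<^sub>k\<close>, with the usual value 0 for negative \<open>k\<close>; with this
  convention its recurrence holds for every integer \<open>k\<close>, and bilateral sums are finite.\<close>

definition rqpoch :: "complex \<Rightarrow> int \<Rightarrow> complex" where
  "rqpoch q k = (if k < 0 then 0 else 1 / qpoch q q (nat k))"

lemma rqpoch_pred:
  assumes "\<And>n. qpoch q q n \<noteq> 0"
  shows "rqpoch q (k - 1) = (1 - q powi k) * rqpoch q k"
proof (cases "k \<le> 0")
  case True
  \<comment> \<open>At \<open>k = 0\<close> the factor \<open>1 - q powi 0\<close> vanishes, in
    agreement with the default value at -1.\<close>
  then show ?thesis by (cases "k = 0") (auto simp: rqpoch_def)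
next
  case False
  then obtain m where m: "k = int (Suc m)"
    by (metis not_le pos_int_cases Suc_pred)
  have "qpoch q q (Suc m) = qpoch q q m * (1 - q ^ Suc m)"
    by (simp add: qpoch_Suc)
  moreover have "nat (k - 1) = m" "nat k = Suc m" "q powi k = q ^ Suc m" "\<not> k - 1 < 0"
    using m by (simp_all del: power_Suc add: power_int_of_nat[of q "Suc m", symmetric] del: power_int_of_nat)
  ultimately show ?thesis
    using False assms[of m] assms[of "Suc m"] by (simp add: rqpoch_def)
qed

lemma rqpoch_sub_4:
  assumes "\<And>n. qpoch q q n \<noteq> 0" "q \<noteq> 0"
  shows "rqpoch q (k - 4) =
    (1 - q powi k / q^3) * (1 - q powi k / q^2) * (1 - q powi k / q) * (1 - q powi k) * rqpoch q k"
proof -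
  have "rqpoch q (k - 4) = (1 - q powi (k-3)) * ((1 - q powi (k-2)) * ((1 - q powi (k-1)) *
      ((1 - q powi k) * rqpoch q k)))"
    using rqpoch_pred[OF assms(1), of k] rqpoch_pred[OF assms(1), of "k-1"]
      rqpoch_pred[OF assms(1), of "k-2"] rqpoch_pred[OF assms(1), of "k-3"] by simp
  then show ?thesis using assms(2) by (simp add: power_int_diff mult.assoc)
qed

section \<open>Bilateral sums, and quotients of shifted products\<close>

text \<open>The indices fill -L, ..., L-1. Pairing \<open>r\<close> with \<open>- r - 1\<close> fits
  the reflection j -> -j-1, which carries 4r+2 and 4r+3 to 4(-r-1)+1 and 4(-r-1).\<close>

definition bisum :: "nat \<Rightarrow> (int \<Rightarrow> complex) \<Rightarrow> complex" where
  "bisum L f = (\<Sum>r<L. f (int r) + f (- int r - 1))"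

lemma bisum_add: "bisum L (\<lambda>r. f r + g r) = bisum L f + bisum L g"
  by (simp add: bisum_def sum.distrib algebra_simps)

lemma bisum_diff: "bisum L (\<lambda>r. f r - g r) = bisum L f - bisum L g"
  by (simp add: bisum_def sum.distrib sum_subtractf algebra_simps)

lemma bisum_mult: "bisum L (\<lambda>r. c * f r) = c * bisum L f"
  by (simp add: bisum_def sum_distrib_left algebra_simps)

lemma bisum_telescope: "bisum L (\<lambda>r. g (r + 1) - g r) = g (int L) - g (- int L)"
proof (induction L)
  case (Suc L)
  have "g (1 + int L) = g (int L + 1)" "g (- 1 - int L) = g (- int L - 1)"
    by (rule arg_cong[where f = g], simp)+
  with Suc show ?case by (simp add: bisum_def)
qed (simp add: bisum_def)

lemma sum_lessThan_mult_4:
  "(\<Sum>j<4 * L. f j) = (\<Sum>r<L. f (4*r) + f (4*r+1) + f (4*r+2) + f (4*r+3 :: nat) :: complex)"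
  by (induction L) (simp_all add: numeral_eq_Suc algebra_simps)

text \<open>The shifted arguments are separate variables so that forms such as
  \<open>q^6 / u\<close> can be matched by an equation.\<close>

lemma qpochs_quotient:
  assumes "\<And>r. qpochs [z1, z2, z3, z4] p r \<noteq> 0"
    and "y1 = p * z1" "y2 = p * z2" "y3 = p * z3" "y4 = p * z4"
  shows "qpochs [y1, y2, y3, y4] p r / qpochs [z1, z2, z3, z4] p r =
    ((1 - z1 * p ^ r) / (1 - z1)) * ((1 - z2 * p ^ r) / (1 - z2)) *
    ((1 - z3 * p ^ r) / (1 - z3)) * ((1 - z4 * p ^ r) / (1 - z4))"
proof -
  have nz: "qpoch z1 p r \<noteq> 0" "qpoch z2 p r \<noteq> 0" "qpoch z3 p r \<noteq> 0" "qpoch z4 p r \<noteq> 0" for r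
    using assms(1)[of r] by (auto simp: qpochs_def)
  have "z1 \<noteq> 1" "z2 \<noteq> 1" "z3 \<noteq> 1" "z4 \<noteq> 1"
    using qpoch_one_sub_ne_0[OF nz(1)] qpoch_one_sub_ne_0[OF nz(2)]
      qpoch_one_sub_ne_0[OF nz(3)] qpoch_one_sub_ne_0[OF nz(4)] .
  then show ?thesis
    using nz[of r] by (simp add: qpochs_def assms(2-) mult.assoc flip: qpoch_shift_quotient)
qed

text \<open>The term of the bilateral sum; it is the \<open>6\<psi>6\<close> summand with base \<open>q\<^sup>4\<close>, up to a factor
  independent of \<open>r\<close>.\<close>

definition wp_term :: "complex \<Rightarrow> nat \<Rightarrow> int \<Rightarrow> complex" where
  "wp_term q n r = q powi (8 * r^2) * (1 - q^2 * (q powi (4*r))^2) *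
     rqpoch q (int n - 4*r) * rqpoch q (int n + 4*r + 2)"

text \<open>With x = q^(4r), this is Y: since (1 - z x)(1 - q^2 x/z) = x (Y - z - q^2/z), the
  parameters meet x only through Y, which is invariant under x -> 1/(q^2 x).\<close>

definition wp_arg :: "complex \<Rightarrow> int \<Rightarrow> complex" where
  "wp_arg q r = 1 / q powi (4*r) + q^2 * q powi (4*r)"

section \<open>Telescoping relations and evaluation of the bilateral sums\<close>

context
  fixes q :: complex
  assumes q0: "q \<noteq> 0" and qq: "\<And>n. qpoch q q n \<noteq> 0"
begin

lemma power_eq_power_imp_eq: "q ^ i = q ^ j \<Longrightarrow> i = j"
proof (induction i j rule: linorder_wlog)
  case (le i j)
  then have "q ^ i * q ^ (j - i) = q ^ i * 1"
    by (metis le_add_diff_inverse mult_1_right power_add)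
  then have "q ^ (j - i) = 1" using q0 by simp
  then show ?case using not_root_of_unity[OF qq, of "j - i"] le(1) by force
qed auto

text \<open>Sums \<open>g\<^bsub>r+1\<^esub> - g\<^sub>r\<close> for an arbitrary weight \<open>\<rho>\<close>.\<close>

lemma telescoped_vanishes:
  assumes "n < L"
  shows "bisum L (\<lambda>r. q powi (8 * r^2) * rqpoch q (int n - 4*r) * rqpoch q (int n + 4*r + 2) *
     (q^4 * (q powi (4*r))^3 * \<rho> (r + 1) *
        ((1 - q^n / q powi (4*r) / q^3) * (1 - q^n / q powi (4*r) / q^2) *
         (1 - q^n / q powi (4*r) / q) * (1 - q^n / q powi (4*r)))
      - \<rho> r / q powi (4*r) *
        ((1 - q^n * q powi (4*r) / q) * (1 - q^n * q powi (4*r)) *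
         (1 - q^n * q powi (4*r) * q) * (1 - q^n * q powi (4*r) * q^2)))) = 0"
    (is "bisum L ?f = 0")
proof -
  define g where "g r = q powi (8 * r^2 - 4*r) * \<rho> r *
      rqpoch q (int n - 4*r) * rqpoch q (int n + 4*r - 2)" for r
  have "?f r = g (r + 1) - g r" for r
  proof -
    have a: "q powi (int n - 4*r) = q^n / q powi (4*r)"
      "q powi (int n + 4*r + 2) = q^n * q powi (4*r) * q^2"
      using q0 by (simp_all add: power_int_diff power_int_add)
    have "8 * (r+1)^2 - 4*(r+1) = 8*r^2 + (4*r + 4*r + 4*r + 4)"
      by (simp add: power2_eq_square algebra_simps)
    then have "q powi (8 * (r+1)^2 - 4*(r+1)) =
        q powi (8*r^2) * (q powi (4*r) * q powi (4*r) * q powi (4*r) * q powi 4)"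
      by (simp only: power_int_add[OF disjI1[OF q0]])
    then have b: "q powi (8 * (r+1)^2 - 4*(r+1)) = q powi (8*r^2) * (q^4 * (q powi (4*r))^3)"
      by (simp add: power3_eq_cube)
    have c: "q powi (8 * r^2 - 4*r) = q powi (8*r^2) / q powi (4*r)"
      using q0 by (simp add: power_int_diff)
    \<comment> \<open>Relative to the two reciprocals in \<open>wp_term\<close>,
      \<open>g (r + 1)\<close> lowers only the first by 4 and \<open>g r\<close> only the second, so
      their product is a common factor.\<close>
    have d: "int n - 4*(r+1) = (int n - 4*r) - 4" "int n + 4*(r+1) - 2 = int n + 4*r + 2"
      "int n + 4*r - 2 = (int n + 4*r + 2) - 4" by simp_all
    have e: "rqpoch q (int n + 4*r + 2 - 4) = (1 - q^n * q powi (4*r) / q) * (1 - q^n * q powi (4*r)) *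
         (1 - q^n * q powi (4*r) * q) * (1 - q^n * q powi (4*r) * q^2) * rqpoch q (int n + 4*r + 2)"
      unfolding rqpoch_sub_4[OF qq q0] a using q0 by (simp add: power2_eq_square power3_eq_cube)
    show ?thesis
      unfolding g_def b c d(1) d(2) unfolding d(3) e rqpoch_sub_4[OF qq q0, of "int n - 4*r"] a
      by (simp add: algebra_simps)
  qed
  then have "bisum L ?f = g (int L) - g (- int L)"
    by (simp add: bisum_telescope)
  \<comment> \<open>At \<open>r = L\<close> the first reciprocal has index n - 4L < 0, at
    \<open>r = - L\<close> the second has index n - 4L - 2 < 0.\<close>
  also have "\<dots> = 0" using assms by (simp add: g_def rqpoch_def)
  finally show ?thesis .
qed

text \<open>This is the telescoping with weight 1. Divided by x, the bracket in
  \<open>telescoped_vanishes\<close> changes sign under x -> 1/(q^2 x); hence 1 - q^2 x^2 splits off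
  and leaves a polynomial in Y, here of degree 1.\<close>

lemma bisum_wp_arg:
  assumes "n < L"
  shows "(q + (q^n)^2) * bisum L (\<lambda>r. wp_term q n r * wp_arg q r) =
    q^n * ((1 + q) * (1 + q^2)) * bisum L (wp_term q n)"
proof -
  define N where "N = q^n"
  have id: "q^4 * x^3 * 1 * ((1 - N / x / q^3) * (1 - N / x / q^2) * (1 - N / x / q) * (1 - N / x))
      - 1 / x * ((1 - N * x / q) * (1 - N * x) * (1 - N * x * q) * (1 - N * x * q^2))
    = (N^2 - q) / q^2 * (1 - q^2 * x^2) * ((q + N^2) * (1 / x + q^2 * x) - N * ((1 + q) * (1 + q^2)))"
    if "x \<noteq> 0" for x
    using that q0 by (simp add: divide_simps) algebra
  have "bisum L (\<lambda>r. (N^2 - q) / q^2 * ((q + N^2) * (wp_term q n r * wp_arg q r)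
      - N * ((1 + q) * (1 + q^2)) * wp_term q n r)) = 0"
    apply (rule trans[OF _ telescoped_vanishes[OF assms, of "\<lambda>_. 1"]])
    apply (rule arg_cong[where f = "bisum L"], rule ext)
    unfolding N_def[symmetric]
    apply (subst id)
    subgoal using q0 by simp
    subgoal unfolding wp_term_def wp_arg_def by algebra
    done
  then have "(N^2 - q) / q^2 * ((q + N^2) * bisum L (\<lambda>r. wp_term q n r * wp_arg q r)
      - N * ((1 + q) * (1 + q^2)) * bisum L (wp_term q n)) = 0"
    by (simp only: bisum_mult bisum_diff)
  \<comment> \<open>The prefactor can be cancelled because N^2 = q^(2n) and 2n is never 1.\<close>
  moreover have "N^2 \<noteq> q"
    using power_eq_power_imp_eq[of "n * 2" 1] by (auto simp: N_def simp flip: power_mult)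
  ultimately show ?thesis using q0 by (simp add: N_def)
qed

text \<open>The weight x/q + q/x is chosen because x -> 1/(q^2 x) exchanges its values at
  \<open>r\<close> and \<open>r + 1\<close>. The antisymmetry of the bracket survives, and the
  quotient by 1 - q^2 x^2 now has degree 2 in Y.\<close>

lemma bisum_wp_arg_sq:
  assumes "n < L"
  shows "(q^6 - (q^n)^4) * bisum L (\<lambda>r. wp_term q n r * (wp_arg q r)^2) =
    (1 + q) * (1 + q^2) * (q^n * q^5 - (q^n)^3) * bisum L (\<lambda>r. wp_term q n r * wp_arg q r) +
    (q^2 * (q^6 - (q^n)^4) - (q^4 - 1) * (q^n)^2 * q * (1 + q + 2*q^2 + q^3 + q^4) - q^4
      + q^6 * (q^n)^4) * bisum L (wp_term q n)"
proof -
  define N where "N = q^n"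
  define A where "A = q^6 - N^4"
  define B where "B = (1 + q) * (1 + q^2) * (N * q^5 - N^3)"
  define C where "C = q^2 * (q^6 - N^4) - (q^4 - 1) * N^2 * q * (1 + q + 2*q^2 + q^3 + q^4) - q^4
      + q^6 * N^4"
  have id: "q^4 * x^3 * (q^4 * x / q + q / (q^4 * x)) *
      ((1 - N / x / q^3) * (1 - N / x / q^2) * (1 - N / x / q) * (1 - N / x))
      - (x / q + q / x) / x * ((1 - N * x / q) * (1 - N * x) * (1 - N * x * q) * (1 - N * x * q^2))
    = (1 - q^2 * x^2) * (- 1 / q^5) * (A * (1 / x + q^2 * x)^2 - B * (1 / x + q^2 * x) - C)"
    if "x \<noteq> 0" for x
    unfolding A_def B_def C_def using that q0 by (simp add: divide_simps) algebra
  have sh: "q powi (4 * (r + 1)) = q^4 * q powi (4*r)" for r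
    using q0 by (simp add: power_int_add algebra_simps)
  have "bisum L (\<lambda>r. (- 1 / q^5) * (A * (wp_term q n r * (wp_arg q r)^2)
      - B * (wp_term q n r * wp_arg q r) - C * wp_term q n r)) = 0"
    apply (rule trans[OF _ telescoped_vanishes[OF assms,
        of "\<lambda>r. q powi (4*r) / q + q / q powi (4*r)"]])
    apply (rule arg_cong[where f = "bisum L"], rule ext)
    unfolding N_def[symmetric] sh
    apply (subst id)
    subgoal using q0 by simp
    subgoal unfolding wp_term_def wp_arg_def by algebra
    done
  then have "(- 1 / q^5) * (A * bisum L (\<lambda>r. wp_term q n r * (wp_arg q r)^2)
      - B * bisum L (\<lambda>r. wp_term q n r * wp_arg q r) - C * bisum L (wp_term q n)) = 0"
    by (simp only: bisum_mult bisum_diff)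
  then have "A * bisum L (\<lambda>r. wp_term q n r * (wp_arg q r)^2)
      = B * bisum L (\<lambda>r. wp_term q n r * wp_arg q r) + C * bisum L (wp_term q n)"
    using q0 by simp algebra
  then show ?thesis by (simp add: A_def B_def C_def N_def)
qed

text \<open>Going from n+1 down to n lowers both reciprocal indices by one; the two factors that
  appear, (1 - M/x)(1 - q^2 M x) with M = q^(n+1), multiply to a linear polynomial in Y.\<close>

lemma wp_term_Suc:
  "wp_term q n r = (1 + q^2 * (q ^ Suc n)^2) * wp_term q (Suc n) r
     - q ^ Suc n * (wp_term q (Suc n) r * wp_arg q r)"
proof -
  have "q powi (int (Suc n) - 4*r) = q ^ Suc n / q powi (4*r)"
    by (simp only: power_int_diff[OF disjI1[OF q0]] power_int_of_nat)
  moreover have "int (Suc n) - 4*r - 1 = int n - 4*r" by simp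
  ultimately have "rqpoch q (int n - 4*r) =
      (1 - q ^ Suc n / q powi (4*r)) * rqpoch q (int (Suc n) - 4*r)"
    using rqpoch_pred[OF qq, of "int (Suc n) - 4*r"] by simp
  moreover have "q powi (int (Suc n) + 4*r + 2) = q ^ Suc n * q powi (4*r) * q^2"
    by (simp only: power_int_add[OF disjI1[OF q0]] power_int_of_nat power_int_numeral)
  moreover have "int (Suc n) + 4*r + 2 - 1 = int n + 4*r + 2" by simp
  ultimately have "rqpoch q (int n - 4*r) =
      (1 - q ^ Suc n / q powi (4*r)) * rqpoch q (int (Suc n) - 4*r)"
    and "rqpoch q (int n + 4*r + 2) =
      (1 - q ^ Suc n * q powi (4*r) * q^2) * rqpoch q (int (Suc n) + 4*r + 2)"
    using rqpoch_pred[OF qq, of "int (Suc n) + 4*r + 2"] by (simp only:)+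
  moreover have "(1 - M / x) * (1 - M * x * q^2) = (1 + q^2 * M^2) - M * (1 / x + q^2 * x)"
    if "x \<noteq> 0" for x M
    using that by (simp add: field_simps power2_eq_square)
  from this[of "q powi (4*r)" "q ^ Suc n"]
  have "(1 - q ^ Suc n / q powi (4*r)) * (1 - q ^ Suc n * q powi (4*r) * q^2) =
      (1 + q^2 * (q ^ Suc n)^2) - q ^ Suc n * wp_arg q r"
    unfolding wp_arg_def using q0 by simp
  moreover have "w * z * A * B = c * (w * z * A' * B') - d * (w * z * A' * B' * e)"
    if "A = a * A'" "B = b * B'" "a * b = c - d * e" for w z A B A' B' a b c d e :: complex
    using that by algebra
  ultimately show ?thesis
    unfolding wp_term_def by blast
qed

lemma bisum_wp_term:
  assumes "n < L"
  shows "bisum L (wp_term q n) = qpoch (- q) (q^2) n / qpoch q q (2*n + 1)"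
  using assms
proof (induction n)
  case 0
  \<comment> \<open>For r > 0 the index -4r is negative, for r < 0 the index 4r+2 is.\<close>
  have z: "wp_term q 0 r = 0" if "r \<noteq> 0" for r
    using that by (simp add: wp_term_def rqpoch_def)
  have "bisum L (wp_term q 0) = (\<Sum>r<L. if r = 0 then wp_term q 0 0 else 0)"
    unfolding bisum_def by (rule sum.cong) (auto simp: z)
  also have "\<dots> = wp_term q 0 0" using 0 by simp
  also have "\<dots> = 1 / (1 - q)"
    using qq[of 2] by (simp add: wp_term_def rqpoch_def qpoch_def numeral_2_eq_2)
  finally show ?case by (simp add: qpoch_def)
next
  case (Suc n)
  define N where "N = q ^ Suc n"
  define T where "T = bisum L (wp_term q (Suc n))"
  define U where "U = bisum L (\<lambda>r. wp_term q (Suc n) r * wp_arg q r)"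
  define P where "P = qpoch q q (2*n + 1)"
  define Q where "Q = qpoch (- q) (q^2) n"
  have N2: "N^2 = q ^ (2*n + 2)" unfolding N_def power_mult[symmetric] by (simp add: mult.commute)
  have "(\<lambda>r. wp_term q n r) = (\<lambda>r. (1 + q^2 * N^2) * wp_term q (Suc n) r
     - N * (wp_term q (Suc n) r * wp_arg q r))"
    using wp_term_Suc[of n] unfolding N_def by blast
  then have "bisum L (wp_term q n) = (1 + q^2 * N^2) * T - N * U"
    unfolding T_def U_def by (simp add: bisum_mult bisum_diff)
  moreover have "(q + N^2) * U = N * ((1 + q) * (1 + q^2)) * T"
    unfolding N_def T_def U_def by (rule bisum_wp_arg) fact
  \<comment> \<open>Eliminating \<open>U\<close> leaves a first-order recurrence in n for the sum of
    \<open>wp_term\<close>.\<close>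
  ultimately have "(q + N^2) * bisum L (wp_term q n) = q * (1 - N^2) * (1 - q * N^2) * T"
    by algebra
  moreover have "bisum L (wp_term q n) = Q / P"
    unfolding P_def Q_def using Suc by simp
  ultimately have e: "(q + N^2) * Q = q * P * ((1 - N^2) * (1 - q * N^2)) * T"
    using qq[of "2*n + 1"] by (simp add: P_def field_simps)
  have p: "qpoch q q (2 * Suc n + 1) = P * ((1 - N^2) * (1 - q * N^2))"
    unfolding P_def N2 by (simp add: qpoch_Suc mult.assoc)
  \<comment> \<open>q + N^2 = q (1 + q^(2n+1)) is q times the last factor of
    \<open>qpoch (- q) (q^2) (Suc n)\<close>.\<close>
  have "q * qpoch (- q) (q^2) (Suc n) = (q + N^2) * Q"
    unfolding Q_def N2 by (simp add: qpoch_Suc algebra_simps flip: power_mult)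
  with e p have "q * qpoch (- q) (q^2) (Suc n) = q * (qpoch q q (2 * Suc n + 1) * T)"
    by (simp add: mult.assoc)
  then show ?case
    using q0 qq[of "2 * Suc n + 1"] unfolding T_def[symmetric]
    by (simp add: nonzero_eq_divide_eq mult.commute)
qed


section \<open>Bailey sums relative to q as bilateral sums\<close>

text \<open>The common frame of both pairs: \<open>P\<close> carries u and v, \<open>a\<close> and
  \<open>b\<close> are the powers of q for even and odd places, and \<open>s\<close> is the extra
  factor 1 or q^n. The Bailey kernel is invariant under j -> -j-1, so the residues 2 and 3 modulo 4
  supply the blocks of negative index.\<close>

lemma bailey_pair_bilateral:
  assumes "\<alpha> 0 = 1"
    and "\<And>r. \<alpha> (4*r) = P (int r) * a (int r)"
    and "\<And>r. \<alpha> (4*r + 1) = P (int r) * b (int r)"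
    and "\<And>r. \<alpha> (4*r + 2) = P (- int r - 1) * b (- int r - 1)"
    and "\<And>r. \<alpha> (4*r + 3) = P (- int r - 1) * a (- int r - 1)"
    and s: "\<And>n r. a r * (rqpoch q (int n - 4*r) * rqpoch q (int n + 4*r + 1)) +
        b r * (rqpoch q (int n - 4*r - 1) * rqpoch q (int n + 4*r + 2)) = s n * wp_term q n r"
    and \<beta>: "\<And>n. \<beta> n = s n * ((1 - q) * bisum (Suc n) (\<lambda>r. P r * wp_term q n r))"
  shows "bailey_pair q q \<alpha> \<beta>"
  unfolding bailey_pair_def
proof (intro conjI allI)
  fix n
  define d where "d j = rqpoch q (int n - j) * rqpoch q (int n + j + 1)" for j
  have "1 - q \<noteq> 0" using not_root_of_unity[OF qq, of 1] by simp
  then have d: "1 / (qpoch q q (n - j) * qpoch (q * q) q (n + j)) = (1 - q) * d (int j)"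
    if "j \<le> n" for j
    using that qpoch_self_Suc[of q "n + j"] qq
    by (simp add: d_def rqpoch_def power2_eq_square nat_diff_distrib' nat_add_distrib)
  have d_refl: "d (- j - 1) = d j" for j
  proof -
    have "int n - (- j - 1) = int n + j + 1" "int n + (- j - 1) + 1 = int n - j" by simp_all
    then show ?thesis by (simp only: d_def mult.commute)
  qed
  have "(\<Sum>j\<le>n. \<alpha> j / (qpoch q q (n - j) * qpoch (q * q) q (n + j))) =
      (\<Sum>j\<le>n. (1 - q) * (\<alpha> j * d (int j)))"
    using d by (intro sum.cong) (simp_all add: divide_inverse)
  \<comment> \<open>Terms with j > n vanish because \<open>d j\<close> contains a reciprocal of
    negative index; the range thus becomes whole blocks of four.\<close>
  also have "\<dots> = (\<Sum>j<4 * Suc n. (1 - q) * (\<alpha> j * d (int j)))"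
    by (rule sum.mono_neutral_left) (auto simp: d_def rqpoch_def)
  also have "\<dots> = (1 - q) * (\<Sum>r<Suc n. \<alpha> (4*r) * d (int (4*r)) + \<alpha> (4*r+1) * d (int (4*r+1)) +
      \<alpha> (4*r+2) * d (int (4*r+2)) + \<alpha> (4*r+3) * d (int (4*r+3)))"
    by (simp only: sum_distrib_left[symmetric] sum_lessThan_mult_4)
  also have "(\<Sum>r<Suc n. \<alpha> (4*r) * d (int (4*r)) + \<alpha> (4*r+1) * d (int (4*r+1)) +
      \<alpha> (4*r+2) * d (int (4*r+2)) + \<alpha> (4*r+3) * d (int (4*r+3))) =
      bisum (Suc n) (\<lambda>r. P r * (a r * d (4*r) + b r * d (4*r + 1)))"
    unfolding bisum_def
  proof (rule sum.cong)
    fix r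
    have "d (int (4*r+2)) = d (4 * (- int r - 1) + 1)" "d (int (4*r+3)) = d (4 * (- int r - 1))"
      by (subst d_refl[symmetric], rule arg_cong[where f = d], simp)+
    moreover have "int (4*r) = 4 * int r" "int (4*r+1) = 4 * int r + 1" by simp_all
    moreover have "x * a * e + x * b * f + y * b' * g + y * a' * h =
        x * (a * e + b * f) + y * (a' * h + b' * g)" for x y a b a' b' e f g h :: complex
      by algebra
    ultimately show "\<alpha> (4*r) * d (int (4*r)) + \<alpha> (4*r+1) * d (int (4*r+1)) +
      \<alpha> (4*r+2) * d (int (4*r+2)) + \<alpha> (4*r+3) * d (int (4*r+3)) =
      P (int r) * (a (int r) * d (4 * int r) + b (int r) * d (4 * int r + 1)) +
      P (- int r - 1) * (a (- int r - 1) * d (4 * (- int r - 1)) +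
        b (- int r - 1) * d (4 * (- int r - 1) + 1))"
      unfolding assms(2-5) by (simp only:)
  qed simp
  also have "(\<lambda>r. P r * (a r * d (4*r) + b r * d (4*r + 1))) = (\<lambda>r. s n * (P r * wp_term q n r))"
  proof
    fix r
    have "a r * d (4*r) + b r * d (4*r + 1) = s n * wp_term q n r"
      using s[of r n] by (simp add: d_def algebra_simps)
    then show "P r * (a r * d (4*r) + b r * d (4*r + 1)) = s n * (P r * wp_term q n r)"
      by simp
  qed
  finally show "\<beta> n = (\<Sum>j\<le>n. \<alpha> j / (qpoch q q (n - j) * qpoch (q * q) q (n + j)))"
    by (simp add: \<beta> bisum_mult)
qed fact

end

section \<open>The common weight of I and J, and K as its mean\<close>

text \<open>The numerator is the product over z = u, v of z Y - (z^2 + q^2), expanded in powers of Y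
  for termwise summation; the denominator is its value at r = 0.\<close>

definition wp_weight :: "complex \<Rightarrow> complex \<Rightarrow> complex \<Rightarrow> int \<Rightarrow> complex" where
  "wp_weight u v q r =
    (u * v * (wp_arg q r)^2 - (u + v) * (q^2 + u * v) * wp_arg q r + (u^2 + q^2) * (v^2 + q^2))
     / ((1 - u) * (q^2 - u) * (1 - v) * (q^2 - v))"

text \<open>Each Pochhammer quotient collapses to (1 - z x)/(1 - z); pairing z with q^2/z produces
  one linear factor in Y.\<close>

lemma I7_eq_wp_weight:
  assumes "q \<noteq> 0" "u \<noteq> 0" "v \<noteq> 0"
    and nz: "\<And>r. qpochs [u, v, q^2 / u, q^2 / v] (q^4) r \<noteq> 0"
  shows "I7 u v q r = (q powi (4 * int r))^2 * wp_weight u v q (int r)"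
proof -
  have "qpoch u (q^4) 1 \<noteq> 0" "qpoch v (q^4) 1 \<noteq> 0"
    "qpoch (q^2/u) (q^4) 1 \<noteq> 0" "qpoch (q^2/v) (q^4) 1 \<noteq> 0"
    using nz[of 1] by (auto simp: qpochs_def)
  then have ne: "1 - u \<noteq> 0" "1 - v \<noteq> 0" "q^2 - u \<noteq> 0" "q^2 - v \<noteq> 0"
    using assms by (auto simp: qpoch_def)
  define x where "x = q powi (4 * int r)"
  have x: "x \<noteq> 0" "(q^4)^r = x"
    using assms(1) by (simp_all add: x_def power_int_mult flip: power_mult)
  have f: "(1 - z * x) / (1 - z) * ((1 - q^2 / z * x) / (1 - q^2 / z)) =
      - x * (z * (1 / x + q^2 * x) - (z^2 + q^2)) / ((1 - z) * (q^2 - z))"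
    if "z \<noteq> 0" "1 - z \<noteq> 0" "q^2 - z \<noteq> 0" for z
    using that x(1) by (simp add: divide_simps) algebra
  have comb: "(- x * A / C) * (- x * B / D) = x^2 * (A * B / (C * D))" for A B C D
    by (simp add: power2_eq_square)
  have "I7 u v q r = ((1 - u * x) / (1 - u) * ((1 - q^2 / u * x) / (1 - q^2 / u))) *
      ((1 - v * x) / (1 - v) * ((1 - q^2 / v * x) / (1 - q^2 / v)))"
  proof -
    have y: "q^6 / z = q^4 * (q^2 / z)" for z by (simp flip: power_add)
    show ?thesis
      unfolding I7_def qpochs_quotient[OF nz refl refl y y] x(2) by (simp only: mult_ac)
  qed
  also have "\<dots> = x^2 * wp_weight u v q (int r)"
    unfolding f[OF assms(2) ne(1) ne(3)] f[OF assms(3) ne(2) ne(4)] comb wp_weight_def wp_arg_def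
      x_def[symmetric]
    by (rule arg_cong[where f = "\<lambda>t. x^2 * t"], rule arg_cong2[where f = "(/)"]; algebra)
  finally show ?thesis by (simp add: x_def)
qed

text \<open>Here z/q^2 is paired with 1/z, and (1 - z x/q^2)(1 - x/z) is x^2/q^2 times the pair of
  \<open>I7\<close> at 1/x; hence the weight at \<open>- int r\<close>.\<close>

lemma J7_eq_wp_weight:
  assumes "q \<noteq> 0" "u \<noteq> 0" "v \<noteq> 0"
    and nz: "\<And>r. qpochs [u / q^2, v / q^2, 1 / u, 1 / v] (q^4) r \<noteq> 0"
  shows "J7 u v q r = (q powi (4 * int r))^2 * wp_weight u v q (- int r)"
proof -
  have "qpoch (u/q^2) (q^4) 1 \<noteq> 0" "qpoch (v/q^2) (q^4) 1 \<noteq> 0"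
    "qpoch (1/u) (q^4) 1 \<noteq> 0" "qpoch (1/v) (q^4) 1 \<noteq> 0"
    using nz[of 1] by (auto simp: qpochs_def)
  then have ne: "1 - u \<noteq> 0" "1 - v \<noteq> 0" "q^2 - u \<noteq> 0" "q^2 - v \<noteq> 0"
    using assms by (auto simp: qpoch_def)
  define x where "x = q powi (4 * int r)"
  have x: "x \<noteq> 0" "(q^4)^r = x" "q powi (4 * - int r) = 1 / x" "1 / (1 / x) = x"
    using assms(1) by (simp_all add: x_def power_int_mult power_int_minus field_simps flip: power_mult)
  have f: "(1 - z / q^2 * x) / (1 - z / q^2) * ((1 - 1 / z * x) / (1 - 1 / z)) =
      - x * (z * (x + q^2 * (1 / x)) - (z^2 + q^2)) / ((1 - z) * (q^2 - z))"
    if "z \<noteq> 0" "1 - z \<noteq> 0" "q^2 - z \<noteq> 0" for z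
    using that x(1) assms(1) by (simp add: divide_simps) algebra
  have comb: "(- x * A / C) * (- x * B / D) = x^2 * (A * B / (C * D))" for A B C D
    by (simp add: power2_eq_square)
  have "J7 u v q r = ((1 - u / q^2 * x) / (1 - u / q^2) * ((1 - 1 / u * x) / (1 - 1 / u))) *
      ((1 - v / q^2 * x) / (1 - v / q^2) * ((1 - 1 / v * x) / (1 - 1 / v)))"
  proof -
    have y: "q^2 * z = q^4 * (z / q^2)" "q^4 / z = q^4 * (1 / z)" for z
      using assms(1) by (simp_all add: power_numeral_reduce)
    show ?thesis
      unfolding J7_def qpochs_quotient[OF nz y(1) y(1) y(2) y(2)] x(2) by (simp only: mult_ac)
  qed
  also have "\<dots> = x^2 * wp_weight u v q (- int r)"
    unfolding f[OF assms(2) ne(1) ne(3)] f[OF assms(3) ne(2) ne(4)] comb wp_weight_def wp_arg_def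
      x(3,4)
    by (rule arg_cong[where f = "\<lambda>t. x^2 * t"], rule arg_cong2[where f = "(/)"]; algebra)
  finally show ?thesis by (simp add: x_def)
qed

text \<open>\<open>Y1\<close> and \<open>Y2\<close> are the means of Y and Y^2 against
  \<open>wp_term\<close> that \<open>bisum_wp_arg\<close> and \<open>bisum_wp_arg_sq\<close> give,
  so \<open>K7\<close> is the mean of \<open>wp_weight\<close>.\<close>

lemma K7_eq:
  assumes "q \<noteq> 0" "N = q^n" "N^2 \<noteq> q" "q + N^2 \<noteq> 0" "q^6 - N^4 \<noteq> 0"
    and "Y1 = N * ((1 + q) * (1 + q^2)) / (q + N^2)"
    and "Y2 = ((1 + q) * (1 + q^2) * (N * q^5 - N^3) * Y1 +
      (q^2 * (q^6 - N^4) - (q^4 - 1) * N^2 * q * (1 + q + 2*q^2 + q^3 + q^4) - q^4 + q^6 * N^4))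
      / (q^6 - N^4)"
  shows "K7 u v q n = (u * v * Y2 - (u + v) * (q^2 + u * v) * Y1 + (u^2 + q^2) * (v^2 + q^2))
     / ((1 - u) * (q^2 - u) * (1 - v) * (q^2 - v))"
proof -
  have N: "N \<noteq> 0" using assms by simp
  \<comment> \<open>\<open>E1\<close>, \<open>E2\<close>, \<open>F\<close>, \<open>G\<close>,
    \<open>H\<close> are the closed forms of the symmetric-function factors in the numerator of K at
    q^i/N, i = 0, ..., 3.\<close>
  define E1 where "E1 = q^2 * ((1 + q) * (1 + q^2)) * (q - N^2) / N^3"
  define E2 where "E2 = q^2 * ((1 + q) * (1 + q^2)) * (q^5 - N^2) / N^3"
  define F where "F = q^4 * (N^2 - q) * (N^2 + q) / N^4"
  define G where "G = q^4 * (N^4 - q^6) / N^4"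
  define H where "H = (q^4 * N^4 - q^3 * N^2 * (1 + q + 2*q^2 + q^3 + q^4) + q^6) / N^4"
  have pw: "q powi (- int n) = 1 / N" "q powi (1 - int n) = q / N"
    "q powi (2 - int n) = q^2 / N" "q powi (3 - int n) = q^3 / N"
    using assms(1,2) by (simp_all add: power_int_diff power_int_minus divide_inverse)
  define b c d e where "b = 1 / N" and "c = q / N" and "d = q^2 / N" and "e = q^3 / N"
  note bcde = b_def c_def d_def e_def
  have E1: "b*c*d + b*c*e + b*d*e + c*d*e - q^2 * (b + c + d + e) = E1"
    unfolding bcde E1_def using N by (simp add: divide_simps) algebra
  have E2: "q^4 * (b*c*d + b*c*e + b*d*e + c*d*e) - q^2 * (b + c + d + e) = E2"
    unfolding bcde E2_def using N by (simp add: divide_simps) algebra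
  have F: "(q^2)^2 - b*c*d*e = F"
    unfolding bcde F_def using N by (simp add: divide_simps) algebra
  have G: "(q^2)^2 - q^4 * (b*c*d*e) = G" "(q^2)^2 - b*c*d*e * q^4 = G"
    unfolding bcde G_def using N by (simp add: divide_simps, algebra)+
  have H: "(q^2)^2 - (b*c + b*d + b*e + c*d + c*e + d*e) * q^2 + b*c*d*e = H"
    unfolding bcde H_def using N by (simp add: divide_simps) algebra
  have FG: "F \<noteq> 0" "G \<noteq> 0" using assms(1,3,4,5) N by (auto simp: F_def G_def add.commute)
  \<comment> \<open>The next two identities compare the coefficients of (u + v)(q^2 + u v) and of u
    v, after division by \<open>F * G\<close>.\<close>
  have Y1: "E1 * q^2 = - Y1 * F"
    unfolding E1_def F_def assms(6) using N assms(4) by (simp add: divide_simps add.commute) algebra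
  have Y2: "E1 * E2 * (q^2)^2 + (1 - q^4) * F * H * q^2 = Y2 * (F * G)"
    unfolding E1_def E2_def F_def G_def H_def assms(6,7) using N assms(4,5)
    by (simp add: divide_simps add.commute) algebra
  have "K7 u v q n = (u * v * E1 * E2 * (q^2)^2 + (1 - q^4) * u * v * F * H * q^2 +
      (u + v) * (q^2 + u * v) * E1 * G * q^2 + (u^2 + q^2) * (v^2 + q^2) * F * G) /
      (F * G * (1 - u) * (q^2 - u) * (1 - v) * (q^2 - v))"
    unfolding K7_def pw bcde[symmetric] K_fun_def Let_def E1 E2 F G H ..
  also have "u * v * E1 * E2 * (q^2)^2 + (1 - q^4) * u * v * F * H * q^2 +
      (u + v) * (q^2 + u * v) * E1 * G * q^2 + (u^2 + q^2) * (v^2 + q^2) * F * G =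
      (F * G) * (u * v * Y2 - (u + v) * (q^2 + u * v) * Y1 + (u^2 + q^2) * (v^2 + q^2))"
    using Y1 Y2 by algebra
  also have "F * G * (1 - u) * (q^2 - u) * (1 - v) * (q^2 - v) =
      (F * G) * ((1 - u) * (q^2 - u) * (1 - v) * (q^2 - v))"
    by (simp only: mult.assoc)
  finally show ?thesis using FG by simp
qed

lemma bisum_wp_weight:
  assumes "q \<noteq> 0" and qq: "\<And>n. qpoch q q n \<noteq> 0"
  shows "(1 - q) * bisum (Suc n) (\<lambda>r. wp_weight u v q r * wp_term q n r) =
    K7 u v q n * (qpoch (- q) (q^2) n / qpoch (q^2) q (2*n))"
proof -
  define N where "N = q^n"
  define S0 where "S0 = bisum (Suc n) (wp_term q n)"
  define S1 where "S1 = bisum (Suc n) (\<lambda>r. wp_term q n r * wp_arg q r)"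
  define S2 where "S2 = bisum (Suc n) (\<lambda>r. wp_term q n r * (wp_arg q r)^2)"
  define D where "D = (1 - u) * (q^2 - u) * (1 - v) * (q^2 - v)"
  define Y1 where "Y1 = N * ((1 + q) * (1 + q^2)) / (q + N^2)"
  define C where "C = q^2 * (q^6 - N^4) - (q^4 - 1) * N^2 * q * (1 + q + 2*q^2 + q^3 + q^4) - q^4
      + q^6 * N^4"
  define Y2 where "Y2 = ((1 + q) * (1 + q^2) * (N * q^5 - N^3) * Y1 + C) / (q^6 - N^4)"
  note inj = power_eq_power_imp_eq[OF assms]
  have N4: "N^4 = q ^ (n * 4)" by (simp add: N_def power_mult)
  \<comment> \<open>Excluding N^4 = q^2 rules out N^2 = q and N^2 = -q together; N^4 = q^6 is the
    remaining zero of a denominator.\<close>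
  have "n * 4 \<noteq> 2" "n * 4 \<noteq> 6" by presburger+
  then have "N^4 \<noteq> q^2" "N^4 \<noteq> q^6" unfolding N4 using inj by blast+
  then have ne: "N^2 \<noteq> q" "q + N^2 \<noteq> 0" and ne': "q^6 - N^4 \<noteq> 0" by algebra+
  have "(q + N^2) * S1 = N * ((1 + q) * (1 + q^2)) * S0"
    unfolding S0_def S1_def N_def by (rule bisum_wp_arg[OF assms]) simp
  then have S1: "S1 = Y1 * S0"
    using ne(2) by (simp add: Y1_def field_simps)
  have "(q^6 - N^4) * S2 = (1 + q) * (1 + q^2) * (N * q^5 - N^3) * S1 + C * S0"
    unfolding S0_def S1_def S2_def N_def C_def by (rule bisum_wp_arg_sq[OF assms]) simp
  also have "\<dots> = (q^6 - N^4) * (Y2 * S0)"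
    using ne' by (simp add: Y2_def S1 distrib_right)
  finally have S2: "S2 = Y2 * S0" using ne' by simp
  have "(\<lambda>r. wp_weight u v q r * wp_term q n r) =
      (\<lambda>r. (1 / D) * (u * v * (wp_term q n r * (wp_arg q r)^2)
        - (u + v) * (q^2 + u * v) * (wp_term q n r * wp_arg q r)
        + (u^2 + q^2) * (v^2 + q^2) * wp_term q n r))"
    unfolding wp_weight_def D_def[symmetric] by (rule ext) algebra
  then have "bisum (Suc n) (\<lambda>r. wp_weight u v q r * wp_term q n r) =
      (1 / D) * (u * v * S2 - (u + v) * (q^2 + u * v) * S1 + (u^2 + q^2) * (v^2 + q^2) * S0)"
    unfolding S0_def S1_def S2_def by (simp only: bisum_mult bisum_diff bisum_add)
  also have "\<dots> = (u * v * Y2 - (u + v) * (q^2 + u * v) * Y1 + (u^2 + q^2) * (v^2 + q^2)) / D * S0"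
    unfolding S1 S2 by algebra
  also have "\<dots> = K7 u v q n * S0"
    unfolding D_def
    by (subst K7_eq[OF assms(1) N_def ne ne' Y1_def Y2_def[unfolded C_def]]) (rule refl)
  finally have "(1 - q) * bisum (Suc n) (\<lambda>r. wp_weight u v q r * wp_term q n r) =
      K7 u v q n * ((1 - q) * S0)" by simp
  also have "(1 - q) * S0 = qpoch (- q) (q^2) n / qpoch (q^2) q (2*n)"
    using bisum_wp_term[OF assms, of n "Suc n"] qpoch_self_Suc[of q "2*n"]
      not_root_of_unity[OF qq, of 1] by (simp add: S0_def)
  finally show ?thesis .
qed

section \<open>The two Bailey pairs\<close>

text \<open>Over the reciprocals of \<open>wp_term\<close>, with N = q^n, these are (1 - q^2 N x) -
  q^2 x^2 (1 - N/x) = 1 - q^2 x^2 and x (1 - q^2 N x) - x (1 - N/x) = N (1 - q^2 x^2). The second is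
  the source of the q^n in part (ii).\<close>

lemma wp_term_split:
  assumes "q \<noteq> 0" and qq: "\<And>n. qpoch q q n \<noteq> 0"
  shows "q powi (8*r^2) * (rqpoch q (int n - 4*r) * rqpoch q (int n + 4*r + 1)) -
      q powi (8*r^2) * (q^2 * (q powi (4*r))^2) *
        (rqpoch q (int n - 4*r - 1) * rqpoch q (int n + 4*r + 2)) = wp_term q n r" (is ?A)
    and "q powi (8*r^2) * q powi (4*r) * (rqpoch q (int n - 4*r) * rqpoch q (int n + 4*r + 1)) -
      q powi (8*r^2) * q powi (4*r) *
        (rqpoch q (int n - 4*r - 1) * rqpoch q (int n + 4*r + 2)) = q^n * wp_term q n r" (is ?B)
proof -
  have "rqpoch q (int n - 4*r - 1) = (1 - q^n / q powi (4*r)) * rqpoch q (int n - 4*r)"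
    using rqpoch_pred[OF qq, of "int n - 4*r"] assms(1) by (simp add: power_int_diff)
  moreover have "rqpoch q (int n + 4*r + 1) =
      (1 - q^n * q powi (4*r) * q^2) * rqpoch q (int n + 4*r + 2)"
  proof -
    have "int n + 4*r + 2 - 1 = int n + 4*r + 1" by simp
    then show ?thesis
      using rqpoch_pred[OF qq, of "int n + 4*r + 2"]
      by (simp only: power_int_add[OF disjI1[OF assms(1)]] power_int_of_nat power_int_numeral)
  qed
  moreover have
    "w * (A * ((1 - N * x * q^2) * B)) - w * (q^2 * x^2) * ((1 - N / x) * A * B) =
      w * (1 - q^2 * x^2) * A * B"
    "w * x * (A * ((1 - N * x * q^2) * B)) - w * x * ((1 - N / x) * A * B) =
      N * (w * (1 - q^2 * x^2) * A * B)" if "x \<noteq> 0" for w x N A B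
    using that by (simp_all add: field_simps power2_eq_square)
  moreover have "q powi (4*r) \<noteq> 0" using assms(1) by simp
  ultimately show ?A ?B
    unfolding wp_term_def by simp_all
qed

lemma power_int_square_shift:
  fixes q :: complex and r :: int
  assumes "q \<noteq> 0"
  defines "x \<equiv> q powi (4*r)"
  shows "q powi (8*r^2 - 4*r) = q powi (8*r^2) / x"
    and "q powi (8*r^2 - 8*r) = q powi (8*r^2) / x^2"
    and "q powi (8*r^2 - 12*r) = q powi (8*r^2) / x^3"
    and "q powi (8*r^2 - 16*r + 2) = q powi (8*r^2) * q^2 / x^4"
    and "q powi (8*r^2 + 2) = q powi (8*r^2) * q^2"
    and "q powi (8*(- r)^2) = q powi (8*r^2)" and "q powi (4*(- r)) = 1 / x"
proof -
  have x: "x^2 = q powi (8*r)" "x^3 = q powi (12*r)" "x^4 = q powi (16*r)"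
    unfolding x_def by (simp_all add: power_int_power' mult.commute)
  show "q powi (8*r^2 - 4*r) = q powi (8*r^2) / x"
    "q powi (8*r^2 - 8*r) = q powi (8*r^2) / x^2"
    "q powi (8*r^2 - 12*r) = q powi (8*r^2) / x^3"
    "q powi (8*r^2 - 16*r + 2) = q powi (8*r^2) * q^2 / x^4"
    "q powi (8*r^2 + 2) = q powi (8*r^2) * q^2"
    "q powi (8*(- r)^2) = q powi (8*r^2)" "q powi (4*(- r)) = 1 / x"
    unfolding x using assms(1)
    by (simp_all add: x_def power_int_diff power_int_add power_int_minus divide_inverse)
qed

theorem theorem2p15:
  fixes u v q :: complex
  assumes "q \<noteq> 0" and "u \<noteq> 0" and "v \<noteq> 0"
    and "\<And>n. qpoch q q n \<noteq> 0"
    and "\<And>r. qpochs [u, v, q^2 / u, q^2 / v] (q^4) r \<noteq> 0"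
    and "\<And>r. qpochs [u / q^2, v / q^2, 1 / u, 1 / v] (q^4) r \<noteq> 0"
  shows
    "(\<forall>\<alpha> \<beta> :: nat \<Rightarrow> complex.
        \<alpha> 0 = 1 \<and> \<beta> 0 = 1 \<and>
        (\<forall>r. \<alpha> (4*r) = I7 u v q r * q powi (8 * int r ^ 2 - 8 * int r)) \<and>
        (\<forall>r. \<alpha> (4*r + 1) = - I7 u v q r * q powi (8 * int r ^ 2 + 2)) \<and>
        (\<forall>r\<ge>1. \<alpha> (4*r - 1) = J7 u v q r * q powi (8 * int r ^ 2 - 8 * int r)) \<and>
        (\<forall>r\<ge>1. \<alpha> (4*r - 2) = - J7 u v q r * q powi (8 * int r ^ 2 - 16 * int r + 2)) \<and>
        (\<forall>n. \<beta> n = K7 u v q n * (qpoch (- q) (q^2) n / qpoch (q^2) q (2*n)))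
        \<longrightarrow> bailey_pair q q \<alpha> \<beta>) \<and>
     (\<forall>\<alpha> \<beta> :: nat \<Rightarrow> complex.
        \<alpha> 0 = 1 \<and> \<beta> 0 = 1 \<and>
        (\<forall>r. \<alpha> (4*r) = I7 u v q r * q powi (8 * int r ^ 2 - 4 * int r)) \<and>
        (\<forall>r. \<alpha> (4*r + 1) = - I7 u v q r * q powi (8 * int r ^ 2 - 4 * int r)) \<and>
        (\<forall>r\<ge>1. \<alpha> (4*r - 1) = J7 u v q r * q powi (8 * int r ^ 2 - 12 * int r)) \<and>
        (\<forall>r\<ge>1. \<alpha> (4*r - 2) = - J7 u v q r * q powi (8 * int r ^ 2 - 12 * int r)) \<and>
        (\<forall>n. \<beta> n = K7 u v q n * (q^n * qpoch (- q) (q^2) n / qpoch (q^2) q (2*n)))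
        \<longrightarrow> bailey_pair q q \<alpha> \<beta>)"
proof (intro conjI allI impI; elim conjE)
  note q0 = assms(1) and qq = assms(4)
  note I7 = I7_eq_wp_weight[OF assms(1,2,3,5)] and J7 = J7_eq_wp_weight[OF assms(1,2,3,6)]
  fix \<alpha> \<beta> :: "nat \<Rightarrow> complex"
  assume \<alpha>: "\<alpha> 0 = 1"
    "\<forall>r. \<alpha> (4*r) = I7 u v q r * q powi (8 * int r ^ 2 - 8 * int r)"
    "\<forall>r. \<alpha> (4*r + 1) = - I7 u v q r * q powi (8 * int r ^ 2 + 2)"
    "\<forall>r\<ge>1. \<alpha> (4*r - 1) = J7 u v q r * q powi (8 * int r ^ 2 - 8 * int r)"
    "\<forall>r\<ge>1. \<alpha> (4*r - 2) = - J7 u v q r * q powi (8 * int r ^ 2 - 16 * int r + 2)"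
    and \<beta>: "\<forall>n. \<beta> n = K7 u v q n * (qpoch (- q) (q^2) n / qpoch (q^2) q (2*n))"
  let ?P = "wp_weight u v q"
  \<comment> \<open>\<open>?a\<close> and \<open>?b\<close> are the given powers of q multiplied by
    the x^2 from \<open>I7_eq_wp_weight\<close>.\<close>
  let ?a = "\<lambda>r. q powi (8*r^2)"
  let ?b = "\<lambda>r. - (q powi (8*r^2) * (q^2 * (q powi (4*r))^2))"
  show "bailey_pair q q \<alpha> \<beta>"
  proof (rule bailey_pair_bilateral[OF q0 qq, where P = ?P and a = ?a and b = ?b and s = "\<lambda>_. 1"])
    fix n r
    show "?a r * (rqpoch q (int n - 4*r) * rqpoch q (int n + 4*r + 1)) +
        ?b r * (rqpoch q (int n - 4*r - 1) * rqpoch q (int n + 4*r + 2)) = 1 * wp_term q n r"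
      using wp_term_split(1)[OF q0 qq, of r n] by simp
  next
    fix n
    show "\<beta> n = 1 * ((1 - q) * bisum (Suc n) (\<lambda>r. ?P r * wp_term q n r))"
      using \<beta> bisum_wp_weight[OF q0 qq] by simp
  next
    fix r
    \<comment> \<open>The formulas with \<open>J7\<close> start at index 1, so 4r+2 and 4r+3 are
      read as 4R-2 and 4R-1, and \<open>J7\<close> at \<open>Suc r\<close> is the weight at -R =
      -r-1.\<close>
    define R where "R = int (Suc r)"
    have e: "4*r + 2 = 4 * Suc r - 2" "4*r + 3 = 4 * Suc r - 1" "- int r - 1 = - R"
      by (simp_all add: R_def)
    note sh = power_int_square_shift[OF q0, of "int r"] power_int_square_shift[OF q0, of R]
    have x: "q powi (4 * int r) \<noteq> 0" "q powi (4 * R) \<noteq> 0" using q0 by simp_all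
    show "\<alpha> (4*r) = ?P (int r) * ?a (int r)"
      unfolding \<alpha>(2)[rule_format] I7 sh using x(1) q0 by (simp add: divide_simps power2_eq_square)
    show "\<alpha> (4*r + 1) = ?P (int r) * ?b (int r)"
      unfolding \<alpha>(3)[rule_format] I7 sh using x(1) q0 by (simp add: divide_simps power2_eq_square)
    have "\<alpha> (4 * Suc r - 2) = ?P (- R) * ?b (- R)"
      by (subst \<alpha>(5)[rule_format])
        (use x(2) q0 in \<open>simp_all only: J7 R_def[symmetric] sh, simp_all add: divide_simps power_numeral_reduce\<close>)
    then show "\<alpha> (4*r + 2) = ?P (- int r - 1) * ?b (- int r - 1)" unfolding e .
    have "\<alpha> (4 * Suc r - 1) = ?P (- R) * ?a (- R)"
      by (subst \<alpha>(4)[rule_format])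
        (use x(2) q0 in \<open>simp_all only: J7 R_def[symmetric] sh, simp_all add: divide_simps power_numeral_reduce\<close>)
    then show "\<alpha> (4*r + 3) = ?P (- int r - 1) * ?a (- int r - 1)" unfolding e .
  qed fact
next
  note q0 = assms(1) and qq = assms(4)
  note I7 = I7_eq_wp_weight[OF assms(1,2,3,5)] and J7 = J7_eq_wp_weight[OF assms(1,2,3,6)]
  fix \<alpha> \<beta> :: "nat \<Rightarrow> complex"
  assume \<alpha>: "\<alpha> 0 = 1"
    "\<forall>r. \<alpha> (4*r) = I7 u v q r * q powi (8 * int r ^ 2 - 4 * int r)"
    "\<forall>r. \<alpha> (4*r + 1) = - I7 u v q r * q powi (8 * int r ^ 2 - 4 * int r)"
    "\<forall>r\<ge>1. \<alpha> (4*r - 1) = J7 u v q r * q powi (8 * int r ^ 2 - 12 * int r)"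
    "\<forall>r\<ge>1. \<alpha> (4*r - 2) = - J7 u v q r * q powi (8 * int r ^ 2 - 12 * int r)"
    and \<beta>: "\<forall>n. \<beta> n = K7 u v q n * (q^n * qpoch (- q) (q^2) n / qpoch (q^2) q (2*n))"
  let ?P = "wp_weight u v q"
  \<comment> \<open>Both given powers are now q^(8r^2)/x, and the x^2 from \<open>I7\<close> turns
    them into q^(8r^2) x.\<close>
  let ?a = "\<lambda>r. q powi (8*r^2) * q powi (4*r)"
  let ?b = "\<lambda>r. - (q powi (8*r^2) * q powi (4*r))"
  show "bailey_pair q q \<alpha> \<beta>"
  proof (rule bailey_pair_bilateral[OF q0 qq, where P = ?P and a = ?a and b = ?b and s = "\<lambda>n. q^n"])
    fix n r
    show "?a r * (rqpoch q (int n - 4*r) * rqpoch q (int n + 4*r + 1)) +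
        ?b r * (rqpoch q (int n - 4*r - 1) * rqpoch q (int n + 4*r + 2)) = q^n * wp_term q n r"
      using wp_term_split(2)[OF q0 qq, of r n] by simp
  next
    fix n
    show "\<beta> n = q^n * ((1 - q) * bisum (Suc n) (\<lambda>r. ?P r * wp_term q n r))"
      unfolding bisum_wp_weight[OF q0 qq] using \<beta> by simp
  next
    fix r
    define R where "R = int (Suc r)"
    have e: "4*r + 2 = 4 * Suc r - 2" "4*r + 3 = 4 * Suc r - 1" "- int r - 1 = - R"
      by (simp_all add: R_def)
    note sh = power_int_square_shift[OF q0, of "int r"] power_int_square_shift[OF q0, of R]
    have x: "q powi (4 * int r) \<noteq> 0" "q powi (4 * R) \<noteq> 0" using q0 by simp_all
    show "\<alpha> (4*r) = ?P (int r) * ?a (int r)"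
      unfolding \<alpha>(2)[rule_format] I7 sh using x(1) q0 by (simp add: divide_simps power2_eq_square)
    show "\<alpha> (4*r + 1) = ?P (int r) * ?b (int r)"
      unfolding \<alpha>(3)[rule_format] I7 sh using x(1) q0 by (simp add: divide_simps power2_eq_square)
    have "\<alpha> (4 * Suc r - 2) = ?P (- R) * ?b (- R)"
      by (subst \<alpha>(5)[rule_format])
        (use x(2) q0 in \<open>simp_all only: J7 R_def[symmetric] sh, simp_all add: divide_simps power_numeral_reduce\<close>)
    then show "\<alpha> (4*r + 2) = ?P (- int r - 1) * ?b (- int r - 1)" unfolding e .
    have "\<alpha> (4 * Suc r - 1) = ?P (- R) * ?a (- R)"
      by (subst \<alpha>(4)[rule_format])
        (use x(2) q0 in \<open>simp_all only: J7 R_def[symmetric] sh, simp_all add: divide_simps power_numeral_reduce\<close>)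
    then show "\<alpha> (4*r + 3) = ?P (- int r - 1) * ?a (- int r - 1)" unfolding e .
  qed fact
qed

end
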